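(* Let $A$ be a finite alphabet with at least two letters, let $\sigma: A\to A^+$ be a primitive, aperiodic substitution with fixed point $u=u_0u_1u_2\cdots\in A^{\mathbb{Z}_+}$. The following are equivalent: (1) the substitution $\sigma$ is not unilaterally recognizable; (2) for each $L\in\mathbb{N}$ there exist $i,j\in\mathbb{Z}_+$ such that $\sigma(u_j)$ is a strict suffix of $\sigma(u_i)$, and $\sigma(u_{i+k})=\sigma(u_{j+k})$ for each integer $k$ with $1\le k\le L$.
   Context: $\mathbb{N}=\{1,2,\dots\}$, $\mathbb{Z}_+=\{0\}\cup\mathbb{N}$. $A^+$ is the set of nonempty finite words over $A$; $|w|$ is the length of a word $w$. A substitution on $A$ is a map $\sigma:A\to A^+$, extended to words and to sequences in $A^{\mathbb{Z}_+}$ by concatenation. It is primitive if there is $k\in\mathbb{N}$ such that for every $(a,b)\in A\times A$ the letter $a$ occurs in $\sigma^k(b)$. It is assumed that $\sigma$ has a fixed point $u=\sigma(u)\in A^{\mathbb{Z}_+}$. $\sigma$ is aperiodic if $T^iu\neq u$ for all $i\in\mathbb{N}$, where $T$ is the left shift on $A^{\mathbb{Z}_+}$. For $i\le j$, $u_{[i,j)}=u_iu_{i+1}\cdots u_{j-1}$. Let $E_1=\{0\}\cup\{|\sigma(u_{[0,n)})| : n\in\mathbb{N}\}$. $\sigma$ is unilaterally recognizable if there exists $L\in\mathbb{N}$ such that whenever $u_{[i,i+L)}=u_{[j,j+L)}$ and $i\in E_1$, then $j\in E_1$ ($i,j\in\mathbb{Z}_+$). A word $s$ is a suffix of a word $v$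 if $v=ps$ for some (possibly empty) word $p$; it is a strict suffix if moreover $|s|<|v|$. *)

theory Defs
  imports "HOL-Library.Stream" "HOL-Library.Sublist" "HOL-Library.Cardinality"
begin

(* The alphabet is the finite type 'a, words are lists, and sequences indexed by
   {0, 1, 2, ...} are streams; the left shift is stl, its i-th power is sdrop i. *)

definition substitution :: "('a \<Rightarrow> 'a list) \<Rightarrow> bool" where
  "substitution \<sigma> \<longleftrightarrow> (\<forall>a. \<sigma> a \<noteq> [])"

definition subst_word :: "('a \<Rightarrow> 'a list) \<Rightarrow> 'a list \<Rightarrow> 'a list" where
  "subst_word \<sigma> w = concat (map \<sigma> w)"

(* flat is the infinite concatenation only if all the words concatenated are nonempty,
   so this is meaningful only if substitution \<sigma> holds. *)
definition subst_seq :: "('a \<Rightarrow> 'a list) \<Rightarrow> 'a stream \<Rightarrow> 'a stream" where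
  "subst_seq \<sigma> x = flat (smap \<sigma> x)"

definition primitive :: "('a \<Rightarrow> 'a list) \<Rightarrow> bool" where
  "primitive \<sigma> \<longleftrightarrow> (\<exists>k\<ge>1. \<forall>a b. a \<in> set ((subst_word \<sigma> ^^ k) [b]))"

(* Aperiodicity and recognizability of a substitution are relative to its chosen
   fixed point u, which is therefore an explicit argument. *)
definition aperiodic :: "'a stream \<Rightarrow> bool" where
  "aperiodic u \<longleftrightarrow> (\<forall>i\<ge>1. sdrop i u \<noteq> u)"

(* The word u_i u_(i+1) ... u_(j-1), for i \<le> j. *)
definition factor :: "'a stream \<Rightarrow> nat \<Rightarrow> nat \<Rightarrow> 'a list" where
  "factor u i j = stake (j - i) (sdrop i u)"

definition E1 :: "('a \<Rightarrow> 'a list) \<Rightarrow> 'a stream \<Rightarrow> nat set" where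
  "E1 \<sigma> u = {0} \<union> {length (subst_word \<sigma> (factor u 0 n)) | n. n \<ge> 1}"

definition unilaterally_recognizable :: "('a \<Rightarrow> 'a list) \<Rightarrow> 'a stream \<Rightarrow> bool" where
  "unilaterally_recognizable \<sigma> u \<longleftrightarrow>
     (\<exists>L\<ge>1. \<forall>i j. factor u i (i + L) = factor u j (j + L) \<and> i \<in> E1 \<sigma> u \<longrightarrow> j \<in> E1 \<sigma> u)"

end

theory Submission
  imports Defs
begin

text \<open>
  Call the elements of \<^const>\<open>E1\<close> the cutting points; they separate the blocks \<open>\<sigma> (u !! n)\<close>.

  If suffix pairs with long common continuations exist, put a copy of the shorter block at the end of
  the longer one: the copy starts strictly inside a block, hence at no cutting point, and reads the
  same long word as the original, so no window length to the right suffices for recognizability.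

  For the converse, the substance is Mosse's bilateral recognizability: a window of fixed length on
  both sides of a position decides whether the position is a cutting point
  (\<open>bilateral_recognizability\<close>). Granted this, consider a long word that occurs at a cutting point
  \<open>i\<close> and at a position \<open>j\<close> that is none. The two occurrences have the same cutting points as soon
  as the two-sided window fits, so there is a last place where they differ. The blocks that end first
  after this place have the same end, and one of them starts earlier: this is the strict suffix.
  All blocks that follow are equal in both occurrences (\<open>last_disagreement_gives_suffix\<close>).

  Bilateral recognizability is a pigeonhole argument over the powers of the substitution. Let a long
  window around \<open>i\<close> agree with one around \<open>j\<close>. For each \<open>p\<close> in a long range, the block
  \<open>\<sigma>\<^sup>p b\<close> around \<open>j\<close> is repeated around \<open>i\<close>, where it lies at some offset inside
  \<open>\<sigma>\<^sup>p v\<close>, for a factor \<open>v\<close> of \<open>u\<close> whose length does not depend on \<open>p\<close>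
  (\<open>block_reappears\<close>); this uses that by primitivity all \<open>\<sigma>\<^sup>p a\<close> have comparable lengths. Carry
  these offsets to a common large order \<open>P\<close> by applying \<open>\<sigma>\<^sup>P\<^sup>-\<^sup>p\<close>. There are boundedly many
  pairs \<open>(b, v)\<close>, and boundedly many offsets up to an error that is small compared with the lengths
  at order \<open>P\<close>; so two orders \<open>p < q\<close> share \<open>b\<close>, \<open>v\<close> and the approximate offset. A small nonzero
  difference of the two offsets would be a short period of \<open>\<sigma>\<^sup>P b\<close>, which linear recurrence and
  aperiodicity exclude (\<open>occurrences_repel\<close>); so the offsets are equal. This means that the occurrence
  of \<open>\<sigma>\<^sup>q b\<close> around \<open>i\<close> is literally the image under \<open>\<sigma>\<^sup>q\<^sup>-\<^sup>p\<close> of an occurrence of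
  \<open>\<sigma>\<^sup>p b\<close> in \<open>u\<close>, just as the block around \<open>j\<close> is. Since \<open>q - p \<ge> 1\<close>, both are cut alike
  (\<open>E1_in_equal_images\<close>), and \<open>i\<close>, \<open>j\<close> are at corresponding places.
\<close>

section \<open>Iterated images and cutting points\<close>

lemma factor_append:
  assumes "i \<le> j" "j \<le> k"
  shows "factor x i j @ factor x j k = factor x i k"
proof -
  have "factor x j k = stake (k - j) (sdrop (j - i) (sdrop i x))"
    using assms by (simp add: factor_def)
  then have "factor x i j @ factor x j k = stake ((j - i) + (k - j)) (sdrop i x)"
    by (simp only: factor_def stake_add)
  then show ?thesis using assms by (simp add: factor_def)
qed

lemma length_factor [simp]: "length (factor x i j) = j - i"
  by (simp add: factor_def)

lemma nth_factor: "t < j - i \<Longrightarrow> factor x i j ! t = x !! (i + t)"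
  by (simp add: factor_def sdrop_snth)

lemma factor_eqI:
  "(\<And>t. t < h \<Longrightarrow> x !! (i + t) = x !! (j + t)) \<Longrightarrow> factor x i (i + h) = factor x j (j + h)"
  by (rule nth_equalityI) (simp_all add: nth_factor)

lemma factor_eqD:
  assumes "factor x i (i + h) = factor x j (j + h)" "t < h"
  shows "x !! (i + t) = x !! (j + t)"
  using arg_cong[OF assms(1), of "\<lambda>w. w ! t"] assms(2) by (simp add: nth_factor)

lemma factor_Suc: "factor x i (Suc i) = [x !! i]"
  by (simp add: factor_def)

lemma factor_split:
  assumes "i \<le> j" "j \<le> k"
  shows "take (j - i) (factor x i k) = factor x i j" "drop (j - i) (factor x i k) = factor x j k"
  using factor_append[OF assms, of x, symmetric] by simp_all

lemma factor_of_occurrence: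
  assumes "factor x i j = v @ w @ z"
  shows "factor x i (i + length v) = v"
    and "factor x (i + length v) (i + length v + length w) = w"
proof -
  have "j - i = length v + length w + length z"
    using arg_cong[OF assms, of length] by simp
  then have le: "i + length v + length w \<le> j \<or> v @ w @ z = []"
    by (cases "length v + length w + length z = 0") (simp, linarith)
  then show "factor x i (i + length v) = v"
    using factor_split(1)[of i "i + length v" j x] assms by (auto simp: factor_def)
  show "factor x (i + length v) (i + length v + length w) = w"
    using le
  proof
    assume "i + length v + length w \<le> j"
    then show ?thesis
      using factor_split(1)[of "i + length v" "i + length v + length w" j x]
        factor_split(2)[of i "i + length v" j x] assms by (simp, metis append_eq_conv_conj)
  qed (simp add: factor_def)
qed

lemma two_occurrences_imp_period:
  assumes eq: "x @ w @ y = x' @ w @ y'" and len: "length x' = length x + d" and t: "t + d < length w"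
  shows "w ! t = w ! (t + d)"
proof -
  have "w ! t = (x' @ w @ y') ! (length x' + t)"
    using t by (simp add: nth_append)
  also have "\<dots> = (x @ w @ y) ! (length x + (t + d))"
    using len by (simp add: eq ac_simps)
  also have "\<dots> = w ! (t + d)"
    using t by (simp only: nth_append_length_plus) (simp add: nth_append)
  finally show ?thesis .
qed

lemma subst_word_append: "subst_word f (v @ w) = subst_word f v @ subst_word f w"
  by (simp add: subst_word_def)

lemma flat_eq_concat_shift:
  assumes "\<forall>w\<in>sset ws. w \<noteq> []"
  shows "flat ws = concat (stake n ws) @- flat (sdrop n ws)"
  using assms
proof (induction n arbitrary: ws)
  case (Suc n)
  have "flat ws = shd ws @- flat (stl ws)"
    using Suc.prems by (intro flat_unfold) (simp add: shd_sset)
  also have "flat (stl ws) = concat (stake n (stl ws)) @- flat (sdrop n (stl ws))"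
    using Suc.prems by (intro Suc.IH) (metis stl_sset)
  finally show ?case by simp
qed simp

locale subst_fixed_point =
  fixes \<sigma> :: "'a::finite \<Rightarrow> 'a list" and u :: "'a stream"
  assumes nonempty: "substitution \<sigma>" and fixed: "subst_seq \<sigma> u = u"
begin

definition img :: "nat \<Rightarrow> 'a list \<Rightarrow> 'a list" where
  "img p w = (subst_word \<sigma> ^^ p) w"

text \<open>For fixed \<open>p\<close>, the increasing enumeration of the cutting points of the \<open>p\<close>-th power of the
  substitution. Including \<open>n = 0\<close> makes \<^const>\<open>E1\<close> the range of the case \<open>p = 1\<close>.\<close>

definition cut :: "nat \<Rightarrow> nat \<Rightarrow> nat" where
  "cut p n = length (img p (factor u 0 n))"

lemma img_0 [simp]: "img 0 w = w"
  and img_1: "img (Suc 0) w = subst_word \<sigma> w"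
  and img_add: "img (p + q) w = img p (img q w)"
  by (simp_all add: img_def funpow_add)

lemma img_append: "img p (v @ w) = img p v @ img p w"
  by (induction p) (simp_all add: img_def subst_word_append)

lemma img_Nil [simp]: "img p [] = []"
  using img_append[of p "[]" "[]"] by simp

lemma img_single_1 [simp]: "img (Suc 0) [a] = \<sigma> a"
  by (simp add: img_1 subst_word_def)

lemma sublist_img: "sublist v w \<Longrightarrow> sublist (img p v) (img p w)"
  unfolding sublist_def using img_append by metis

lemma length_le_img: "length w \<le> length (img p w)"
proof (induction p)
  case (Suc p)
  have "length v \<le> length (subst_word \<sigma> v)" for v
  proof (induction v)
    case (Cons a v)
    have "\<sigma> a \<noteq> []" using nonempty by (simp add: substitution_def)
    then have "1 \<le> length (\<sigma> a)" by (simp add: Suc_leI)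
    then show ?case using Cons by (simp add: subst_word_def)
  qed simp
  then have "length (img p w) \<le> length (img (Suc p) w)"
    by (simp add: img_def)
  then show ?case using Suc by linarith
qed simp

lemma factor_0_eq_stake: "factor u 0 n = stake n u"
  by (simp add: factor_def)

text \<open>The infinite concatenation enters only here: that images of inner factors are found at the
  cutting points follows by cancelling a common prefix.\<close>

lemma factor_0_cut: "factor u 0 (cut p n) = img p (factor u 0 n)"
proof (induction p)
  case 0
  show ?case by (simp add: cut_def)
next
  case (Suc p)
  have *: "stake (length (subst_word \<sigma> (stake m u))) u = subst_word \<sigma> (stake m u)" for m
  proof -
    have "u = flat (smap \<sigma> u)" using fixed by (simp add: subst_seq_def)
    also have "\<dots> = concat (stake m (smap \<sigma> u)) @- flat (sdrop m (smap \<sigma> u))"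
      using nonempty by (intro flat_eq_concat_shift) (auto simp: substitution_def stream.set_map)
    finally have "u = subst_word \<sigma> (stake m u) @- flat (sdrop m (smap \<sigma> u))"
      by (simp add: subst_word_def)
    then show ?thesis
      by (metis append_Nil2 diff_self_eq_0 order_refl stake.simps(1) stake_shift take_all_iff)
  qed
  have "cut (Suc p) n = length (subst_word \<sigma> (stake (cut p n) u))"
    using Suc by (simp add: cut_def img_def factor_0_eq_stake)
  then show ?case
    using *[of "cut p n"] Suc by (simp add: img_def factor_0_eq_stake)
qed

lemma cut_0 [simp]: "cut p 0 = 0"
  by (simp add: cut_def factor_def)

lemma cut_add: "cut (p + q) n = cut p (cut q n)"
  by (simp add: cut_def[of "p + q"] img_add cut_def[of p "cut q n"] factor_0_cut)

lemma cut_eq: "m \<le> n \<Longrightarrow> cut p n = cut p m + length (img p (factor u m n))"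
  using factor_append[of 0 m n u] unfolding cut_def length_append[symmetric] img_append[symmetric]
  by simp

lemma cut_mono: "m \<le> n \<Longrightarrow> cut p m \<le> cut p n"
  by (simp add: cut_eq)

lemma cut_strict_mono: "m < n \<Longrightarrow> cut p m < cut p n"
  using length_le_img[of "factor u m n" p] cut_eq[of m n p] unfolding length_factor by linarith

lemma cut_less_iff: "cut p m < cut p n \<longleftrightarrow> m < n"
  by (meson cut_mono cut_strict_mono not_le)

lemma cut_le_iff: "cut p m \<le> cut p n \<longleftrightarrow> m \<le> n"
  by (meson cut_mono cut_strict_mono not_le)

lemma cut_Suc: "cut p (Suc n) = cut p n + length (img p [u !! n])"
  by (simp add: cut_eq[of n "Suc n"] factor_Suc)

lemma factor_cut: 
  assumes "m \<le> n"
  shows "factor u (cut p m) (cut p n) = img p (factor u m n)"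
proof -
  have "factor u 0 (cut p m) @ factor u (cut p m) (cut p n) = factor u 0 (cut p n)"
    using assms by (intro factor_append) (simp_all add: cut_mono)
  also have "\<dots> = img p (factor u 0 m) @ img p (factor u m n)"
    using assms by (simp add: factor_0_cut factor_append flip: img_append)
  finally show ?thesis by (simp add: factor_0_cut)
qed

lemma block_of_position:
  obtains n where "cut p n \<le> j" "j < cut p (Suc n)"
proof -
  have "\<exists>n. cut p n \<le> j \<and> j < cut p (Suc n)"
  proof (induction j)
    case 0
    then show ?case using cut_strict_mono[of 0 "Suc 0" p] by (intro exI[of _ 0]) simp
  next
    case (Suc j)
    then obtain n where n: "cut p n \<le> j" "j < cut p (Suc n)" by blast
    show ?case
    proof (cases "Suc j < cut p (Suc n)")
      case True
      then show ?thesis using n by (intro exI[of _ n]) auto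
    next
      case False
      then have "Suc j = cut p (Suc n)" using n by simp
      then show ?thesis
        using cut_strict_mono[of "Suc n" "Suc (Suc n)" p] by (intro exI[of _ "Suc n"]) simp
    qed
  qed
  then show ?thesis using that by blast
qed

lemma E1_eq: "E1 \<sigma> u = range (cut (Suc 0))"
proof -
  have *: "cut (Suc 0) n = length (subst_word \<sigma> (factor u 0 n))" for n
    by (simp add: cut_def img_1)
  show ?thesis
  proof (intro equalityI subsetI)
    fix x
    assume "x \<in> E1 \<sigma> u"
    then have "x = cut (Suc 0) 0 \<or> (\<exists>n. x = cut (Suc 0) n)"
      by (auto simp: E1_def simp flip: *)
    then show "x \<in> range (cut (Suc 0))" by blast
  next
    fix x
    assume "x \<in> range (cut (Suc 0))"
    then obtain n where "x = cut (Suc 0) n" by blast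
    then show "x \<in> E1 \<sigma> u"
      by (cases n) (auto simp: E1_def simp flip: *)
  qed
qed

text \<open>Inside an image of order \<open>Suc r\<close> the cutting points of order one depend only on the word
  whose image is taken, because they are the ends of images of prefixes of its \<open>r\<close>-th image.\<close>

lemma E1_in_equal_images:
  assumes eq: "factor u c (c + h) = factor u c' (c' + h)"
    and e: "e \<le> length (img (Suc r) (factor u c (c + h)))"
    and mem: "cut (Suc r) c + e \<in> E1 \<sigma> u"
  shows "cut (Suc r) c' + e \<in> E1 \<sigma> u"
proof -
  have cS: "cut (Suc r) n = cut (Suc 0) (cut r n)" for n
    using cut_add[of "Suc 0" r n] by simp
  obtain a where a: "cut (Suc r) c + e = cut (Suc 0) a"
    using mem by (auto simp: E1_eq)
  have lo: "cut r c \<le> a"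
    using a cS cut_le_iff[of "Suc 0"] by (metis le_add1)
  have "cut (Suc 0) a \<le> cut (Suc r) (c + h)"
    using e a cut_eq[of c "c + h" "Suc r"] by simp
  then have hi: "a \<le> cut r (c + h)"
    by (simp add: cS cut_le_iff)
  define t where "t = a - cut r c"
  have word: "factor u (cut r c) a = factor u (cut r c') (cut r c' + t)"
  proof -
    have len: "cut r (c' + h) - cut r c' = cut r (c + h) - cut r c"
      using cut_eq[of c "c + h" r] cut_eq[of c' "c' + h" r] eq by simp
    have "factor u (cut r c) a = take t (img r (factor u c (c + h)))"
      using factor_split(1)[OF lo hi, of u] factor_cut[of c "c + h" r] by (simp add: t_def)
    moreover have "factor u (cut r c') (cut r c' + t) = take t (img r (factor u c' (c' + h)))"
      using factor_split(1)[of "cut r c'" "cut r c' + t" "cut r (c' + h)" u]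
        factor_cut[of c' "c' + h" r] lo hi len cut_mono[of c' "c' + h" r]
        cut_mono[of c "c + h" r] by (simp add: t_def)
    ultimately show ?thesis using eq by simp
  qed
  have "cut (Suc 0) a = cut (Suc r) c + length (img (Suc 0) (factor u (cut r c) a))"
    using cut_eq[OF lo, of "Suc 0"] by (simp add: cS)
  then have "e = length (img (Suc 0) (factor u (cut r c) a))"
    using a by simp
  then have "cut (Suc r) c' + e = cut (Suc 0) (cut r c' + t)"
    using cut_eq[of "cut r c'" "cut r c' + t" "Suc 0"] word by (simp add: cS)
  then show ?thesis by (simp add: E1_eq)
qed

text \<open>The \<open>L\<close> letters read from the cutting point before the block of \<open>j\<close> are also read from the
  start \<open>q\<close> of its copy in the block of \<open>i\<close>, and \<open>q\<close> lies strictly inside that block.\<close>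

lemma suffix_images_agree_imp_not_recognizable:
  assumes "\<forall>L\<ge>1. \<exists>i j. strict_suffix (\<sigma> (u !! j)) (\<sigma> (u !! i)) \<and>
       (\<forall>k. 1 \<le> k \<and> k \<le> L \<longrightarrow> \<sigma> (u !! (i + k)) = \<sigma> (u !! (j + k)))"
  shows "\<not> unilaterally_recognizable \<sigma> u"
proof
  assume "unilaterally_recognizable \<sigma> u"
  then obtain L where L: "L \<ge> 1"
    and rec: "\<And>i j. factor u i (i + L) = factor u j (j + L) \<Longrightarrow> i \<in> E1 \<sigma> u \<Longrightarrow> j \<in> E1 \<sigma> u"
    unfolding unilaterally_recognizable_def by blast
  obtain i j where suf: "strict_suffix (\<sigma> (u !! j)) (\<sigma> (u !! i))"
    and agree: "\<And>k. 1 \<le> k \<Longrightarrow> k \<le> L \<Longrightarrow> \<sigma> (u !! (i + k)) = \<sigma> (u !! (j + k))"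
    using assms L by blast
  let ?c = "cut (Suc 0)"
  obtain p where p: "\<sigma> (u !! i) = p @ \<sigma> (u !! j)" "p \<noteq> []"
    using suf by (auto simp: strict_suffix_def suffix_def)
  have ne: "\<sigma> (u !! j) \<noteq> []" using nonempty by (simp add: substitution_def)
  define q where "q = ?c i + length p"
  have q_split: "?c (Suc i) = q + length (\<sigma> (u !! j))"
    using cut_Suc[of "Suc 0" i] p by (simp add: q_def)
  have tails: "img (Suc 0) (factor u (Suc i) (Suc i + k)) = img (Suc 0) (factor u (Suc j) (Suc j + k))"
    if "k \<le> L" for k
    using that
  proof (induction k)
    case (Suc k)
    have split: "factor u (Suc n) (Suc n + Suc k) = factor u (Suc n) (Suc n + k) @ [u !! (n + Suc k)]" for n
      using factor_append[of "Suc n" "Suc n + k" "Suc n + Suc k" u] factor_Suc[of u "Suc n + k"] by simp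
    show ?case
      using Suc agree[of "Suc k"] by (simp only: split img_append img_single_1)
  qed (simp add: factor_def)
  have drop_p: "factor u q (?c (Suc i)) = \<sigma> (u !! j)"
    using factor_split(2)[of "?c i" q "?c (Suc i)" u] factor_cut[of i "Suc i" "Suc 0"] p q_split
    by (simp add: q_def factor_Suc)
  let ?w = "img (Suc 0) (factor u (Suc j) (Suc j + L))"
  have qw: "factor u q (?c (Suc i + L)) = \<sigma> (u !! j) @ ?w"
    using factor_append[of q "?c (Suc i)" "?c (Suc i + L)" u] drop_p tails[of L]
      factor_cut[of "Suc i" "Suc i + L" "Suc 0"] q_split cut_mono[of "Suc i" "Suc i + L" "Suc 0"]
    by simp
  have jw: "factor u (?c j) (?c (Suc j + L)) = \<sigma> (u !! j) @ ?w"
    using factor_append[of "?c j" "?c (Suc j)" "?c (Suc j + L)" u]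
      factor_cut[of "Suc j" "Suc j + L" "Suc 0"] factor_cut[of j "Suc j" "Suc 0"]
      cut_mono[of "Suc j" "Suc j + L" "Suc 0"] cut_mono[of "j" "Suc j" "Suc 0"]
    by (simp add: factor_Suc)
  have long: "L \<le> length (\<sigma> (u !! j) @ ?w)"
    using length_le_img[of "factor u (Suc j) (Suc j + L)" "Suc 0"] by simp
  have pre: "factor u a (a + L) = take L (factor u a b)" if "L \<le> length (factor u a b)" for a b
    using factor_split(1)[of a "a + L" b u] that L by simp
  have "factor u (?c j) (?c j + L) = factor u q (q + L)"
    using pre[of "?c j" "?c (Suc j + L)"] pre[of q "?c (Suc i + L)"] long unfolding qw jw by simp
  then have "q \<in> E1 \<sigma> u" using rec by (simp add: E1_eq)
  then obtain a where "q = ?c a" by (auto simp: E1_eq)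
  moreover have "?c i < q" "q < ?c (Suc i)" using p ne q_split by (simp_all add: q_def)
  ultimately show False by (simp add: cut_less_iff)
qed

end

section \<open>Primitivity: balanced lengths and linear recurrence\<close>

locale primitive_fixed_point = subst_fixed_point +
  assumes two_letters: "CARD('a) \<ge> 2" and primitive: "primitive \<sigma>" and aperiodic: "aperiodic u"
begin

definition minlen :: "nat \<Rightarrow> nat" where
  "minlen p = Min (range (\<lambda>a. length (img p [a])))"

definition maxlen :: "nat \<Rightarrow> nat" where
  "maxlen p = Max (range (\<lambda>a. length (img p [a])))"

lemma minlen_le: "minlen p \<le> length (img p [a])"
  by (simp add: minlen_def)

lemma maxlen_ge: "length (img p [a]) \<le> maxlen p"
  by (simp add: maxlen_def)

lemma minlen_attained: "\<exists>a. minlen p = length (img p [a])"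
  using Min_in[of "range (\<lambda>a. length (img p [a]))"] unfolding minlen_def
  by (simp add: image_iff)

lemma maxlen_attained: "\<exists>a. maxlen p = length (img p [a])"
  using Max_in[of "range (\<lambda>a. length (img p [a]))"] unfolding maxlen_def
  by (simp add: image_iff)

lemma minlen_pos: "0 < minlen p"
  using minlen_attained[of p] length_le_img[of "[a]" p for a] by (metis Suc_le_lessD length_Cons list.size(3))

lemma length_img_le: "length (img p w) \<le> length w * maxlen p"
proof (induction w)
  case (Cons a w)
  then show ?case
    using img_append[of p "[a]" w] maxlen_ge[of p a] by simp
qed simp

lemma length_img_ge: "length w * minlen p \<le> length (img p w)"
proof (induction w)
  case (Cons a w)
  then show ?case
    using img_append[of p "[a]" w] minlen_le[of p a] by simp
qed simp

lemma maxlen_add: "maxlen (p + q) \<le> maxlen q * maxlen p"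
proof -
  obtain a where "maxlen (p + q) = length (img p (img q [a]))"
    using maxlen_attained[of "p + q"] by (auto simp: img_add)
  also have "\<dots> \<le> length (img q [a]) * maxlen p" by (rule length_img_le)
  also have "\<dots> \<le> maxlen q * maxlen p" using maxlen_ge by (intro mult_right_mono) simp_all
  finally show ?thesis .
qed

lemma all_letters_occur: "\<exists>k. \<forall>a b. sublist [a] (img k [b])"
proof -
  have "sublist [a] w" if "a \<in> set w" for a :: 'a and w
    using split_list[OF that] by (auto simp: sublist_def)
  then show ?thesis
    using primitive unfolding primitive_def img_def by blast
qed

text \<open>The longest image of order \<open>r\<close> occurs inside every image of order \<open>r + k\<close>, where \<open>k\<close> is an
  exponent of primitivity, and passing from \<open>r\<close> to \<open>r + k\<close> multiplies lengths by at most a constant.\<close>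

lemma balanced_lengths: "\<exists>k C. \<forall>p\<ge>k. maxlen p \<le> C * minlen p"
proof -
  obtain k where k: "\<And>a b. sublist [a] (img k [b])" using all_letters_occur by blast
  have "maxlen p \<le> maxlen k * minlen p" if p: "k \<le> p" for p
  proof -
    obtain r where r: "p = r + k" using le_Suc_ex[OF p] by (auto simp: add.commute)
    obtain a where a: "maxlen r = length (img r [a])" using maxlen_attained by blast
    obtain b where b: "minlen p = length (img p [b])" using minlen_attained by blast
    have "sublist (img r [a]) (img p [b])"
      unfolding r img_add by (rule sublist_img[OF k])
    then have "maxlen r \<le> minlen p" using a b by (simp add: sublist_length_le)
    then show ?thesis
      using maxlen_add[of r k] r by (meson le_trans mult_le_mono2)
  qed
  then show ?thesis by blast
qed

lemma images_grow: "\<exists>t. N \<le> length (img t [a])"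
proof -
  obtain k where k: "\<And>a b. sublist [a] (img k [b])" using all_letters_occur by blast
  have two: "2 \<le> minlen k"
  proof -
    obtain b where b: "minlen k = length (img k [b])" using minlen_attained by blast
    have "set (img k [b]) = UNIV" using set_mono_sublist[OF k] by auto
    then show ?thesis using two_letters card_length[of "img k [b]"] b by simp
  qed
  have "2 ^ n \<le> length (img (n * k) [a])" for n
  proof (induction n)
    case (Suc n)
    have "2 * length (img (n * k) [a]) \<le> length (img (n * k) [a]) * minlen k"
      using two by simp
    also have "\<dots> \<le> length (img (Suc n * k) [a])"
      using length_img_ge by (simp add: img_add)
    finally show ?case using Suc by simp
  qed simp
  then show ?thesis using less_exp[of N] by (meson le_trans less_imp_le)
qed

text \<open>There are finitely many factors of length two, all in one prefix of the fixed point, and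
  this prefix is contained in an image of its first letter.\<close>

lemma two_letter_factors_occur: "\<exists>s. \<forall>n b. sublist (factor u n (n + 2)) (img s [b])"
proof -
  obtain k where k: "\<And>a b. sublist [a] (img k [b])" using all_letters_occur by blast
  let ?two = "\<lambda>n. factor u n (n + 2)"
  have "finite {w :: 'a list. set w \<subseteq> UNIV \<and> length w = 2}"
    by (rule finite_lists_length_eq) simp
  then have "finite (range ?two)"
    by (rule rev_finite_subset) auto
  then obtain I where I: "finite I" "range ?two = ?two ` I"
    using finite_subset_image[of "range ?two" ?two UNIV] by auto
  obtain t where t: "Max (insert 0 I) + 2 \<le> length (img t [u !! 0])"
    using images_grow by blast
  have "sublist (?two n) (img (t + k) [b])" for n b
  proof -
    have "?two n \<in> ?two ` I" unfolding I(2)[symmetric] by (rule rangeI)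
    then obtain m where m: "m \<in> I" "?two n = ?two m" by (elim imageE)
    have "m \<le> Max (insert 0 I)" using I(1) m(1) by simp
    then have le: "m + 2 \<le> cut t (Suc 0)"
      using t cut_Suc[of t 0] by simp
    have "img t [u !! 0] = factor u 0 (cut t (Suc 0))"
      by (simp add: factor_0_cut factor_Suc)
    also have "\<dots> = factor u 0 m @ ?two m @ factor u (m + 2) (cut t (Suc 0))"
      using le by (simp add: factor_append)
    finally have "sublist (?two m) (img t [u !! 0])" by simp
    moreover have "sublist (img t [u !! 0]) (img (t + k) [b])"
      unfolding img_add by (rule sublist_img[OF k])
    ultimately show ?thesis using m(2) sublist_order.order.trans by metis
  qed
  then show ?thesis by blast
qed

text \<open>Linear recurrence: a factor no longer than any image of order \<open>r\<close> meets at most two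
  consecutive images of that order.\<close>

lemma short_factors_occur:
  "\<exists>s. \<forall>r b n h. h \<le> minlen r \<longrightarrow> sublist (factor u n (n + h)) (img (r + s) [b])"
proof -
  obtain s where s: "\<And>n b. sublist (factor u n (n + 2)) (img s [b])"
    using two_letter_factors_occur by blast
  have "sublist (factor u n (n + h)) (img (r + s) [b])" if "h \<le> minlen r" for r b n h
  proof -
    obtain a where a: "cut r a \<le> n" "n < cut r (Suc a)" by (rule block_of_position)
    have "cut r (Suc a) + minlen r \<le> cut r (a + 2)"
      using cut_Suc[of r "Suc a"] minlen_le[of r "u !! Suc a"] by simp
    then have b: "n + h \<le> cut r (a + 2)" using a that by linarith
    have "factor u (cut r a) (cut r (a + 2)) =
        factor u (cut r a) n @ factor u n (n + h) @ factor u (n + h) (cut r (a + 2))"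
      using a b by (simp add: factor_append)
    then have "sublist (factor u n (n + h)) (img r (factor u a (a + 2)))"
      using factor_cut[of a "a + 2" r] by (metis le_add1 sublist_appendI)
    moreover have "sublist (img r (factor u a (a + 2))) (img (r + s) [b])"
      unfolding img_add by (rule sublist_img[OF s])
    ultimately show ?thesis using sublist_order.order.trans by metis
  qed
  then show ?thesis by blast
qed

text \<open>If a word of period \<open>d\<close> contains every factor of length \<open>d + 1\<close>, then the first and the last
  letter of each such factor are equal, so the whole sequence has period \<open>d\<close>.\<close>

lemma no_short_period:
  assumes s: "\<And>n h. h \<le> minlen r \<Longrightarrow> sublist (factor u n (n + h)) w"
    and per: "\<And>t. t + d < length w \<Longrightarrow> w ! t = w ! (t + d)"
    and d: "d < minlen r"
  shows "d = 0"
proof (rule ccontr)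
  assume "d \<noteq> 0"
  have "u !! n = u !! (n + d)" for n
  proof -
    obtain x y where w: "w = x @ factor u n (n + Suc d) @ y"
      using s[of "Suc d" n] d by (auto simp: sublist_def)
    have at: "w ! (length x + t) = u !! (n + t)" if "t \<le> d" for t
      unfolding w using that by (simp only: nth_append_length_plus) (simp add: nth_append nth_factor)
    show ?thesis
      using per[of "length x"] at[of 0] at[of d] by (simp add: w)
  qed
  then have "smap id u = sdrop d u"
    unfolding smap_alt by (simp add: sdrop_snth add.commute)
  then have "sdrop d u = u" by (simp add: stream.map_id)
  then show False using \<open>d \<noteq> 0\<close> aperiodic by (simp add: aperiodic_def)
qed

text \<open>Two occurrences of a word at distance \<open>d\<close> give it the period \<open>d\<close>, and offsets with the same
  quotient by \<open>minlen r\<close> differ by less than \<open>minlen r\<close>. Stating closeness by equal quotients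
  suits the pigeonhole argument, which needs finitely many classes.\<close>

lemma occurrences_repel:
  "\<exists>s. \<forall>r b x y x' y'. x @ img (r + s) [b] @ y = x' @ img (r + s) [b] @ y' \<longrightarrow>
     length x div minlen r = length x' div minlen r \<longrightarrow> length x = length x'"
proof -
  obtain s where s: "\<And>r b n h. h \<le> minlen r \<Longrightarrow> sublist (factor u n (n + h)) (img (r + s) [b])"
    using short_factors_occur by blast
  have main: "length x = length x'"
    if eq: "x @ img (r + s) [b] @ y = x' @ img (r + s) [b] @ y'"
      and bucket: "length x div minlen r = length x' div minlen r"
      and le: "length x \<le> length x'" for r b x y x' y'
  proof -
    define d where "d = length x' - length x"
    have len: "length x' = length x + d" using le by (simp add: d_def)
    have "d < minlen r"
    proof (rule ccontr)
      assume "\<not> d < minlen r"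
      then have "length x + minlen r \<le> length x'" using len by simp
      then have "(length x + minlen r) div minlen r \<le> length x' div minlen r"
        by (rule div_le_mono)
      moreover have "(length x + minlen r) div minlen r = Suc (length x div minlen r)"
        using minlen_pos[of r] div_add_self2[of "minlen r" "length x"] by linarith
      ultimately show False using bucket by linarith
    qed
    then have "d = 0"
      using no_short_period[OF s two_occurrences_imp_period[OF eq len]] by blast
    then show ?thesis using len by simp
  qed
  have "length x = length x'"
    if "x @ img (r + s) [b] @ y = x' @ img (r + s) [b] @ y'"
      and "length x div minlen r = length x' div minlen r" for r b x y x' y'
    using main[OF that] main[OF that(1)[symmetric] that(2)[symmetric]] by (cases "length x \<le> length x'") auto
  then show ?thesis by blast
qed

section \<open>Bilateral recognizability\<close>

text \<open>The block of order \<open>p\<close> around \<open>j\<close> reappears around \<open>i\<close>, where it is covered by a number of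
  blocks of order \<open>p\<close> that does not depend on \<open>p\<close>: the part before it and the block itself
  have length at most \<open>maxlen p\<close> each, and \<open>2 * C\<close> blocks have length at least \<open>2 * maxlen p\<close>.\<close>

lemma block_reappears:
  assumes balanced: "maxlen p \<le> C * minlen p"
    and L: "maxlen p \<le> L" "L \<le> i" "L \<le> j"
    and win: "factor u (i - L) (i + L) = factor u (j - L) (j + L)"
  shows "\<exists>n n' x y. cut p n \<le> j \<and> j < cut p (Suc n) \<and>
     img p (factor u n' (n' + 2 * C)) = x @ img p [u !! n] @ y \<and>
     i + cut p n = cut p n' + length x + j"
proof -
  obtain n where n: "cut p n \<le> j" "j < cut p (Suc n)" by (rule block_of_position)
  define h where "h = length (img p [u !! n])"
  have h: "h \<le> maxlen p" "cut p (Suc n) = cut p n + h"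
    using maxlen_ge[of p "u !! n"] by (simp_all add: h_def cut_Suc)
  have near: "j - cut p n \<le> L" using n h L by linarith
  define i0 where "i0 = i - (j - cut p n)"
  have i0: "i + cut p n = i0 + j" using near n L by (simp add: i0_def)
  have same: "factor u i0 (i0 + h) = factor u (cut p n) (cut p n + h)"
  proof (rule factor_eqI)
    fix t assume t: "t < h"
    define t' where "t' = L - (j - cut p n) + t"
    have "t' < 2 * L" using t h L n near by (simp add: t'_def)
    then have "u !! (i - L + t') = u !! (j - L + t')"
      using win L factor_eqD[of u "i - L" "2 * L" "j - L" t'] by (simp add: mult_2)
    moreover have "i - L + t' = i0 + t" "j - L + t' = cut p n + t"
      using near n L by (simp_all add: t'_def i0_def)
    ultimately show "u !! (i0 + t) = u !! (cut p n + t)" by simp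
  qed
  obtain n' where n': "cut p n' \<le> i0" "i0 < cut p (Suc n')" by (rule block_of_position)
  have end_le: "i0 + h \<le> cut p (n' + 2 * C)"
  proof -
    have "i0 + h \<le> cut p n' + 2 * maxlen p"
      using n' h cut_Suc[of p n'] maxlen_ge[of p "u !! n'"] by linarith
    also have "\<dots> \<le> cut p n' + (2 * C) * minlen p" using balanced by simp
    also have "\<dots> \<le> cut p n' + length (img p (factor u n' (n' + 2 * C)))"
      using length_img_ge[of "factor u n' (n' + 2 * C)" p] by simp
    also have "\<dots> = cut p (n' + 2 * C)" using cut_eq[of n' "n' + 2 * C" p] by simp
    finally show ?thesis .
  qed
  have "img p (factor u n' (n' + 2 * C)) = factor u (cut p n') (cut p (n' + 2 * C))"
    using factor_cut[of n' "n' + 2 * C" p] by simp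
  also have "\<dots> = factor u (cut p n') i0 @ factor u i0 (i0 + h) @ factor u (i0 + h) (cut p (n' + 2 * C))"
    using n' end_le by (simp add: factor_append)
  also have "factor u i0 (i0 + h) = img p [u !! n]"
    using same factor_cut[of n "Suc n" p] h by (simp add: factor_Suc)
  finally show ?thesis
    using n n' i0 by (intro exI[of _ n] exI[of _ n'] exI[of _ "factor u (cut p n') i0"]
        exI[of _ "factor u (i0 + h) (cut p (n' + 2 * C))"]) simp
qed

text \<open>The orders below \<open>k\<close> are left out because lengths are balanced only from \<open>k\<close> on. The offset of
  order \<open>p\<close> is recorded at the common order \<open>P\<close>, where it is the length of \<open>img (P - p) (X p)\<close>.\<close>

theorem bilateral_recognizability:
  "\<exists>L. \<forall>i j. L \<le> i \<longrightarrow> L \<le> j \<longrightarrow> factor u (i - L) (i + L) = factor u (j - L) (j + L) \<longrightarrow>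
     i \<in> E1 \<sigma> u \<longrightarrow> j \<in> E1 \<sigma> u"
proof -
  obtain k C where bal: "\<And>p. k \<le> p \<Longrightarrow> maxlen p \<le> C * minlen p"
    using balanced_lengths by blast
  obtain s where repel: "\<And>r b x y x' y'. x @ img (r + s) [b] @ y = x' @ img (r + s) [b] @ y' \<Longrightarrow>
     length x div minlen r = length x' div minlen r \<Longrightarrow> length x = length x'"
    using occurrences_repel by blast
  \<comment> \<open>\<open>B * minlen r\<close> bounds the length of an image of order \<open>r + s\<close> of a word of length \<open>2 * C\<close>.\<close>
  define B where "B = 2 * C * (maxlen s * C)"
  define S where "S = (UNIV :: 'a set) \<times> {w :: 'a list. set w \<subseteq> UNIV \<and> length w = 2 * C} \<times> {..B}"
  have fin: "finite S"
    unfolding S_def using finite_lists_length_eq[of "UNIV :: 'a set"] by (intro finite_cartesian_product) simp_all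
  \<comment> \<open>Then \<open>{k..P}\<close> has more than \<open>card S\<close> elements.\<close>
  define r where "r = k + card S"
  define P where "P = r + s"
  define L where "L = Max (maxlen ` {k..P})"
  have "j \<in> E1 \<sigma> u"
    if L: "L \<le> i" "L \<le> j" and win: "factor u (i - L) (i + L) = factor u (j - L) (j + L)"
      and i: "i \<in> E1 \<sigma> u" for i j
  proof -
    have "\<forall>p\<in>{k..P}. \<exists>n n' x y. cut p n \<le> j \<and> j < cut p (Suc n) \<and>
     img p (factor u n' (n' + 2 * C)) = x @ img p [u !! n] @ y \<and> i + cut p n = cut p n' + length x + j"
    proof
      fix p assume p: "p \<in> {k..P}"
      then have "maxlen p \<le> L" by (simp add: L_def)
      then show "\<exists>n n' x y. cut p n \<le> j \<and> j < cut p (Suc n) \<and>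
         img p (factor u n' (n' + 2 * C)) = x @ img p [u !! n] @ y \<and> i + cut p n = cut p n' + length x + j"
        using block_reappears[OF bal _ L win] p by simp
    qed
    then obtain N N' X Y where block: "\<And>p. p \<in> {k..P} \<Longrightarrow> cut p (N p) \<le> j \<and> j < cut p (Suc (N p))"
      and cover: "\<And>p. p \<in> {k..P} \<Longrightarrow>
          img p (factor u (N' p) (N' p + 2 * C)) = X p @ img p [u !! N p] @ Y p"
      and pos: "\<And>p. p \<in> {k..P} \<Longrightarrow> i + cut p (N p) = cut p (N' p) + length (X p) + j"
      by metis
    define v where "v p = factor u (N' p) (N' p + 2 * C)" for p
    define \<phi> where "\<phi> p = (u !! N p, v p, length (img (P - p) (X p)) div minlen r)" for p
    have lift: "img P (v p) = img (P - p) (X p) @ img P [u !! N p] @ img (P - p) (Y p)"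
      if "p \<in> {k..P}" for p
      using cover[OF that] img_add[of "P - p" p] that by (simp add: v_def img_append)
    have "\<phi> p \<in> S" if p: "p \<in> {k..P}" for p
    proof -
      have "length (img (P - p) (X p)) \<le> length (img P (v p))"
        using lift[OF p] by simp
      also have "\<dots> \<le> 2 * C * maxlen P"
        using length_img_le[of P "v p"] by (simp add: v_def)
      also have "\<dots> \<le> 2 * C * (maxlen s * (C * minlen r))"
        using maxlen_add[of r s] bal[of r]
        by (intro mult_le_mono2) (metis P_def le_add1 le_trans mult_le_mono2 r_def)
      also have "\<dots> = B * minlen r" by (simp add: B_def)
      finally have "length (img (P - p) (X p)) div minlen r \<le> B"
        using minlen_pos[of r] by (metis div_le_mono nonzero_mult_div_cancel_right neq0_conv)
      then show ?thesis by (simp add: S_def \<phi>_def v_def)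
    qed
    then have "card (\<phi> ` {k..P}) \<le> card S"
      by (intro card_mono fin) auto
    also have "\<dots> < card {k..P}" by (simp add: P_def r_def)
    finally have "\<not> inj_on \<phi> {k..P}" by (rule pigeonhole)
    then obtain p q where pq: "p \<in> {k..P}" "q \<in> {k..P}" "p < q" and same: "\<phi> p = \<phi> q"
      unfolding inj_on_def by (metis linorder_neqE_nat)
    define b where "b = u !! N q"
    have b: "u !! N p = b" "u !! N q = b" and v: "v p = v q"
      and bucket: "length (img (P - p) (X p)) div minlen r = length (img (P - q) (X q)) div minlen r"
      using same by (simp_all add: \<phi>_def b_def)
    have len: "length (img (P - p) (X p)) = length (img (P - q) (X q))"
    proof (rule repel[OF _ bucket])
      show "img (P - p) (X p) @ img (r + s) [b] @ img (P - p) (Y p) =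
            img (P - q) (X q) @ img (r + s) [b] @ img (P - q) (Y q)"
        using lift[OF pq(1)] lift[OF pq(2)] b v by (simp flip: P_def)
    qed
    \<comment> \<open>Equal offsets at order \<open>P\<close> are equal already at order \<open>q\<close>, as both prefixes lie in the same
      word and images never shrink.\<close>
    define z where "z = img (q - p) (X p)"
    have z: "z = X q"
    proof -
      have "img q (v q) = img (q - p) (img p (v p))"
        using pq(3) v img_add[of "q - p" p] by simp
      then have "z @ (img (q - p) (img p [b]) @ img (q - p) (Y p)) = X q @ (img q [b] @ Y q)"
        using cover[OF pq(1)] cover[OF pq(2)] b by (simp add: v_def img_append z_def)
      moreover have "length (img (P - q) z) = length (img (P - q) (X q))"
        using len pq img_add[of "P - q" "q - p" "X p"] by (simp add: z_def)
      moreover have "w = []" if "length (img (P - q) (x @ w)) = length (img (P - q) x)" for x w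
        using that length_le_img[of w "P - q"] by (simp add: img_append)
      ultimately show ?thesis
        unfolding append_eq_append_conv2 by (metis append_Nil2)
    qed
    \<comment> \<open>The occurrence of \<open>img p [b]\<close> whose image of order \<open>q - p\<close> surrounds \<open>i\<close>.\<close>
    define c where "c = cut p (N' q) + length (X p)"
    have word: "factor u (cut p (N' q)) (cut p (N' q + 2 * C)) = X p @ img p [b] @ Y p"
      using factor_cut[of "N' q" "N' q + 2 * C" p] cover[OF pq(1)] v b by (simp add: v_def)
    have cut_c: "cut (q - p) c = cut q (N' q) + length (X q)"
      using cut_eq[of "cut p (N' q)" c "q - p"] cut_add[of "q - p" p] pq(3) z
        factor_of_occurrence(1)[OF word] by (simp add: c_def z_def)
    have cut_n: "cut (q - p) (cut p (N q)) = cut q (N q)"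
      using cut_add[of "q - p" p] pq(3) by simp
    let ?h = "length (img p [b])"
    have at_c: "factor u c (c + ?h) = img p [b]"
      using factor_of_occurrence(2)[OF word] by (simp add: c_def)
    have at_n: "factor u (cut p (N q)) (cut p (N q) + ?h) = img p [b]"
      using factor_cut[of "N q" "Suc (N q)" p] b by (simp add: cut_Suc factor_Suc)
    have suc: "Suc (q - p - 1) = q - p" using pq(3) by simp
    have "cut (Suc (q - p - 1)) (cut p (N q)) + (j - cut q (N q)) \<in> E1 \<sigma> u"
    proof (rule E1_in_equal_images)
      show "factor u c (c + ?h) = factor u (cut p (N q)) (cut p (N q) + ?h)"
        using at_c at_n by simp
      have "img (q - p) (img p [b]) = img q [b]"
        using img_add[of "q - p" p] pq(3) by simp
      then show "j - cut q (N q) \<le> length (img (Suc (q - p - 1)) (factor u c (c + ?h)))"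
        using block[OF pq(2)] b at_c unfolding suc by (simp add: cut_Suc, linarith)
      have "cut (q - p) c + (j - cut q (N q)) = i"
        using pos[OF pq(2)] block[OF pq(2)] cut_c by simp
      then show "cut (Suc (q - p - 1)) c + (j - cut q (N q)) \<in> E1 \<sigma> u"
        unfolding suc using i by simp
    qed
    then show ?thesis
      using block[OF pq(2)] cut_n unfolding suc by simp
  qed
  then show ?thesis by blast
qed

section \<open>The last disagreement of cutting points\<close>

text \<open>Where the cutting points agree beyond a place at which only one of the two occurrences has a
  cutting point, the block that ends first after that place is longer in the other occurrence,
  and all later blocks coincide.\<close>

lemma last_disagreement_gives_suffix:
  assumes win: "factor u a (a + W) = factor u b (b + W)"
    and W: "(l + 1) * maxlen (Suc 0) \<le> W"
    and a: "a \<in> E1 \<sigma> u" and b: "b \<notin> E1 \<sigma> u"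
    and agree: "\<And>t. 0 < t \<Longrightarrow> t \<le> W \<Longrightarrow> a + t \<in> E1 \<sigma> u \<longleftrightarrow> b + t \<in> E1 \<sigma> u"
  shows "\<exists>i j. strict_suffix (\<sigma> (u !! j)) (\<sigma> (u !! i)) \<and>
       (\<forall>k. 1 \<le> k \<and> k \<le> l \<longrightarrow> \<sigma> (u !! (i + k)) = \<sigma> (u !! (j + k)))"
proof -
  let ?c = "cut (Suc 0)"
  let ?M = "maxlen (Suc 0)"
  have E1_iff: "x \<in> E1 \<sigma> u \<longleftrightarrow> (\<exists>n. x = ?c n)" for x by (auto simp: E1_eq)
  have step: "?c (Suc x) \<le> ?c x + ?M" for x
    using cut_Suc[of "Suc 0" x] maxlen_ge[of "Suc 0" "u !! x"] by simp
  have strict: "?c x < ?c (Suc x)" for x by (rule cut_strict_mono) simp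
  have sigma: "\<sigma> (u !! x) = factor u (?c x) (?c (Suc x))" for x
    using factor_cut[of x "Suc x" "Suc 0"] by (simp add: factor_Suc)
  have gap: "x \<notin> E1 \<sigma> u" if "?c y < x" "x < ?c (Suc y)" for x y
    using that by (auto simp: E1_iff cut_less_iff)
  have shifted: "factor u (a + s) (a + t) = factor u (b + s) (b + t)" if "s \<le> t" "t \<le> W" for s t
    using that factor_split(1)[of a "a + t" "a + W" u] factor_split(1)[of b "b + t" "b + W" u]
      factor_split(2)[of a "a + s" "a + t" u] factor_split(2)[of b "b + s" "b + t" u] win by simp
  obtain n where n: "a = ?c n" using a by (auto simp: E1_iff)
  define g where "g = ?c (Suc n) - a"
  have g: "0 < g" "g \<le> W" "?c (Suc n) = a + g" 
    using strict[of n] step[of n] W n by (simp_all add: g_def)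
  have "a + g \<in> E1 \<sigma> u" using g(3) E1_iff by metis
  then have "b + g \<in> E1 \<sigma> u" using agree[of g] g by simp
  then obtain m' where m': "b + g = ?c m'" by (auto simp: E1_iff)
  then obtain m where m: "b + g = ?c (Suc m)" using g(1) by (cases m') auto
  \<comment> \<open>Otherwise the block ending at \<open>b + g\<close> would start at \<open>b\<close>, which is no cutting point, or later,
    at a cutting point that the block of \<open>a\<close> does not have.\<close>
  have before: "?c m < b"
  proof (rule ccontr)
    assume "\<not> ?c m < b"
    then obtain t where t: "?c m = b + t" by (metis le_iff_add not_less)
    then have "t \<noteq> 0" using b E1_iff by (metis add_0_right)
    have "t < g" using strict[of m] m t by simp
    have "b + t \<in> E1 \<sigma> u" unfolding E1_iff t[symmetric] by blast
    then have "a + t \<in> E1 \<sigma> u" using agree[of t] \<open>t \<noteq> 0\<close> \<open>t < g\<close> g by simp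
    moreover have "a + t \<notin> E1 \<sigma> u" using gap[of n "a + t"] \<open>t \<noteq> 0\<close> \<open>t < g\<close> g n by simp
    ultimately show False by simp
  qed
  have suffix: "strict_suffix (\<sigma> (u !! n)) (\<sigma> (u !! m))"
  proof -
    have "\<sigma> (u !! m) = factor u (?c m) b @ factor u b (b + g)"
      using before m by (simp add: sigma factor_append)
    also have "factor u b (b + g) = \<sigma> (u !! n)"
      using shifted[of 0 g] g n by (simp add: sigma)
    finally have "\<sigma> (u !! m) = factor u (?c m) b @ \<sigma> (u !! n)" .
    moreover have "factor u (?c m) b \<noteq> []" using before by (simp add: factor_def)
    ultimately show ?thesis by (auto simp: strict_suffix_def suffix_def)
  qed
  have sync: "\<exists>t. 0 < t \<and> t \<le> (k + 1) * ?M \<and> ?c (Suc n + k) = a + t \<and> ?c (Suc m + k) = b + t"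
    if "k \<le> l" for k
    using that
  proof (induction k)
    case 0
    show ?case using g m step[of n] n by (intro exI[of _ g]) simp
  next
    case (Suc k)
    then obtain t where t: "0 < t" "t \<le> (k + 1) * ?M" "?c (Suc n + k) = a + t" "?c (Suc m + k) = b + t"
      by auto
    have bound: "(Suc k + 1) * ?M \<le> W"
      using Suc.prems W by (meson add_le_mono1 le_trans mult_le_mono1)
    define d where "d = ?c (Suc (Suc n + k)) - ?c (Suc n + k)"
    define e where "e = ?c (Suc (Suc m + k)) - ?c (Suc m + k)"
    have d: "0 < d" "d \<le> ?M" "?c (Suc (Suc n + k)) = a + (t + d)"
      using strict[of "Suc n + k"] step[of "Suc n + k"] t by (simp_all add: d_def)
    have e: "0 < e" "e \<le> ?M" "?c (Suc (Suc m + k)) = b + (t + e)"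
      using strict[of "Suc m + k"] step[of "Suc m + k"] t by (simp_all add: e_def)
    have td: "t + d \<le> W" and te: "t + e \<le> W" using d e t bound by simp_all
    have "a + (t + d) \<in> E1 \<sigma> u" "b + (t + e) \<in> E1 \<sigma> u"
      using E1_iff d(3) e(3) by metis+
    then have cuts: "b + (t + d) \<in> E1 \<sigma> u" "a + (t + e) \<in> E1 \<sigma> u"
      using agree[of "t + d"] agree[of "t + e"] td te t(1) by simp_all
    have "\<not> d < e"
      using gap[of "Suc m + k" "b + (t + d)"] cuts(1) d(1) e(3) t(4) by auto
    moreover have "\<not> e < d"
      using gap[of "Suc n + k" "a + (t + e)"] cuts(2) e(1) d(3) t(3) by auto
    ultimately have "d = e" by simp
    then show ?case
      using d e t by (intro exI[of _ "t + d"]) simp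
  qed
  have "\<sigma> (u !! (m + k)) = \<sigma> (u !! (n + k))" if k: "1 \<le> k" "k \<le> l" for k
  proof -
    obtain k' where k': "k = Suc k'" using k(1) by (cases k) auto
    obtain s where s: "?c (n + k) = a + s" "?c (m + k) = b + s"
      using sync[of k'] k(2) k' by auto
    obtain t where t: "t \<le> (k + 1) * ?M" "?c (Suc (n + k)) = a + t" "?c (Suc (m + k)) = b + t"
      using sync[of k] k by auto
    have "s \<le> t" using strict[of "n + k"] s t by simp
    moreover have "t \<le> W"
      using t(1) W k by (meson add_le_mono1 le_trans mult_le_mono1)
    ultimately show ?thesis
      using shifted[of s t] by (simp add: sigma s t)
  qed
  then show ?thesis using suffix by blast
qed

lemma not_recognizable_imp_suffix_images_agree:
  assumes "\<not> unilaterally_recognizable \<sigma> u"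
  shows "\<exists>i j. strict_suffix (\<sigma> (u !! j)) (\<sigma> (u !! i)) \<and>
       (\<forall>k. 1 \<le> k \<and> k \<le> l \<longrightarrow> \<sigma> (u !! (i + k)) = \<sigma> (u !! (j + k)))"
proof -
  obtain L where bil: "\<And>i j. L \<le> i \<Longrightarrow> L \<le> j \<Longrightarrow> factor u (i - L) (i + L) = factor u (j - L) (j + L) \<Longrightarrow>
     i \<in> E1 \<sigma> u \<Longrightarrow> j \<in> E1 \<sigma> u"
    using bilateral_recognizability by blast
  define V where "V = (l + 1) * maxlen (Suc 0)"
  define W where "W = 2 * L + V + 1"
  obtain i j where win: "factor u i (i + W) = factor u j (j + W)" and i: "i \<in> E1 \<sigma> u" and j: "j \<notin> E1 \<sigma> u"
    using assms unfolding unilaterally_recognizable_def by (metis W_def le_add2)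
  have sub: "factor u (i + s) (i + t) = factor u (j + s) (j + t)" if "s \<le> t" "t \<le> W" for s t
    using that factor_split(1)[of i "i + t" "i + W" u] factor_split(1)[of j "j + t" "j + W" u]
      factor_split(2)[of i "i + s" "i + t" u] factor_split(2)[of j "j + s" "j + t" u] win by simp
  \<comment> \<open>Disagreements at most \<open>L + V\<close>: those from \<open>L\<close> on have room for \<open>L\<close> letters on both sides.\<close>
  define D where "D = {t. t \<le> L + V \<and> (i + t \<in> E1 \<sigma> u) \<noteq> (j + t \<in> E1 \<sigma> u)}"
  have D: "finite D" "0 \<in> D" using i j by (simp_all add: D_def)
  define t where "t = Max D"
  have tD: "t \<in> D" unfolding t_def using D by (intro Max_in) auto
  have after: "i + x \<in> E1 \<sigma> u \<longleftrightarrow> j + x \<in> E1 \<sigma> u" if "t < x" "x \<le> L + V" for x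
  proof -
    have "x \<notin> D" using that(1) Max_ge[OF D(1), of x] by (auto simp: t_def)
    then show ?thesis using that(2) by (simp add: D_def)
  qed
  have "t < L"
  proof (rule ccontr)
    assume "\<not> t < L"
    then have "factor u (i + t - L) (i + t + L) = factor u (j + t - L) (j + t + L)"
      using sub[of "t - L" "t + L"] tD by (simp add: D_def W_def add.assoc)
    then have "i + t \<in> E1 \<sigma> u \<longleftrightarrow> j + t \<in> E1 \<sigma> u"
      using bil[of "i + t" "j + t"] bil[of "j + t" "i + t"] \<open>\<not> t < L\<close> by auto
    then show False using tD by (simp add: D_def)
  qed
  have win_t: "factor u (i + t) (i + t + V) = factor u (j + t) (j + t + V)"
    using sub[of t "t + V"] \<open>t < L\<close> by (simp add: W_def add.assoc)
  have after_t: "i + t + x \<in> E1 \<sigma> u \<longleftrightarrow> j + t + x \<in> E1 \<sigma> u" if "0 < x" "x \<le> V" for x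
    using after[of "t + x"] that \<open>t < L\<close> by (simp add: add.assoc)
  show ?thesis
  proof (cases "i + t \<in> E1 \<sigma> u")
    case True
    then show ?thesis
      using last_disagreement_gives_suffix[OF win_t _ _ _ after_t, of l] tD by (simp add: D_def V_def)
  next
    case False
    then show ?thesis
      using last_disagreement_gives_suffix[OF win_t[symmetric] _ _ _ after_t[symmetric], of l] tD
      by (simp add: D_def V_def)
  qed
qed

end

theorem theorem1p1:
  fixes \<sigma> :: "'a::finite \<Rightarrow> 'a list" and u :: "'a stream"
  assumes "CARD('a) \<ge> 2"
    and "substitution \<sigma>"
    and "primitive \<sigma>"
    and "subst_seq \<sigma> u = u"
    and "aperiodic u"
  shows "\<not> unilaterally_recognizable \<sigma> u \<longleftrightarrow>
    (\<forall>L\<ge>1. \<exists>i j. strict_suffix (\<sigma> (u !! j)) (\<sigma> (u !! i)) \<and>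
       (\<forall>k. 1 \<le> k \<and> k \<le> L \<longrightarrow> \<sigma> (u !! (i + k)) = \<sigma> (u !! (j + k))))"
proof -
  interpret primitive_fixed_point \<sigma> u
    using assms by unfold_locales
  show ?thesis
    using not_recognizable_imp_suffix_images_agree suffix_images_agree_imp_not_recognizable by blast
qed

end
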